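(* Let $G$ be a connected graph of order $n$, and let $S\subseteq V(G)$ with $1\leq |S|<n$ be such that the induced subgraph $G[S]$ is $n_1$-regular. Assume that $V(G)-S=B\cup T$, where each vertex in $B$ is adjacent to all the vertices in $S$, and each vertex in $T$ is adjacent to none of the vertices in $S$. Set $H=G-S$ and $\rho=\rho(G)$. Then $$\frac{|S|}{\rho(\rho-n_1)}\left(|B|+\sum_{i\geq 1}\frac{W^{i}_{B}(H)}{\rho^{i}}\right)=1.$$
   Context: All graphs are finite, undirected, without parallel edges or loops. The spectral radius $\rho(G)$ of a graph $G$ is the largest eigenvalue of its adjacency matrix. For an integer $\ell\geq 1$, a walk of length $\ell$ (an $\ell$-walk) in a graph $H$ is an ordered sequence of vertices $v_0,v_1,\ldots,v_\ell$ such that $v_i$ is adjacent to $v_{i+1}$ for every $0\leq i\leq \ell-1$; $v_0$ and $v_\ell$ are its starting and end vertices. For a graph $H$, a set $B\subseteq V(H)$ and a vertex $u$ of $H$, $w^{\ell}_{H,B}(u)$ is the number of $\ell$-walks of $H$ that start at $u$ and end at some vertex in $B$ (intermediate vertices may be any vertices of $H$), and $W^{\ell}_{B}(H)=\sum_{v\in B}w^{\ell}_{H,B}(v)$. *)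

theory Defs
  imports
    Complex_Main
    "Graph_Theory.Graph_Theory"
    "Jordan_Normal_Form.Char_Poly"
begin

text \<open>
  A finite simple undirected graph is a symmetric, loop-free digraph without parallel arcs
  (locale \<open>graph\<close> of Graph_Theory), each edge being a pair of opposite arcs.  Hence the
  degree of a vertex is its out-degree, and adjacency is \<open>u \<rightarrow>\<^bsub>G\<^esub> v\<close>, that is
  \<open>(u, v) \<in> arcs_ends G\<close>.
\<close>

definition regular_graph :: "('a, 'b) pre_digraph \<Rightarrow> nat \<Rightarrow> bool" where
  "regular_graph G k \<longleftrightarrow> (\<forall>v\<in>verts G. out_degree G v = k)"

definition adjacency_mat :: "('a, 'b) pre_digraph \<Rightarrow> 'a list \<Rightarrow> real mat" where
  "adjacency_mat G vs = mat (length vs) (length vs)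
     (\<lambda>(i, j). if (vs ! i, vs ! j) \<in> arcs_ends G then 1 else 0)"

text \<open>
  The rows and columns of a matrix are numbered, so the adjacency matrix depends on an
  enumeration of the vertices.  Its eigenvalues do not (lemma
  \<open>eigenvalue_adjacency_mat_iff\<close> below), so any enumeration may be chosen.  Only real
  eigenvalues are considered; the matrix is symmetric, so there are no others.
\<close>

definition graph_spectral_radius :: "('a, 'b) pre_digraph \<Rightarrow> real" where
  "graph_spectral_radius G =
     Max {k. eigenvalue (adjacency_mat G (SOME vs. distinct vs \<and> set vs = verts G)) k}"

definition num_walks :: "('a, 'b) pre_digraph \<Rightarrow> 'a set \<Rightarrow> nat \<Rightarrow> 'a \<Rightarrow> nat" where
  "num_walks H B l u = card {p. vwalk p H \<and> vwalk_length p = l \<and> hd p = u \<and> last p \<in> B}"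

definition total_walks :: "('a, 'b) pre_digraph \<Rightarrow> 'a set \<Rightarrow> nat \<Rightarrow> nat" where
  "total_walks H B l = (\<Sum>v\<in>B. num_walks H B l v)"

lemma eigenvalue_adjacency_mat_iff:
  assumes vs: "distinct vs" "set vs = verts G"
  shows "eigenvalue (adjacency_mat G vs) k \<longleftrightarrow>
    (\<exists>x. (\<exists>v\<in>verts G. x v \<noteq> 0) \<and>
         (\<forall>u\<in>verts G. (\<Sum>v\<in>verts G. (if (u, v) \<in> arcs_ends G then 1 else 0) * x v) = k * x u))"
    (is "?L \<longleftrightarrow> ?R")
proof -
  let ?n = "length vs" and ?a = "\<lambda>u v. if (u, v) \<in> arcs_ends G then 1 else (0::real)"
  have bij: "bij_betw (\<lambda>i. vs ! i) {0..<?n} (verts G)"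
    using bij_betw_nth[OF vs(1), of "{..<?n}" "verts G"] vs(2) by (simp add: atLeast0LessThan)
  have sum_eq: "(\<Sum>v\<in>verts G. f v) = (\<Sum>j = 0..<?n. f (vs ! j))" for f :: "'a \<Rightarrow> real"
    using sum.reindex_bij_betw[OF bij, of f] by simp
  have all_eq: "(\<forall>u\<in>verts G. P u) \<longleftrightarrow> (\<forall>i<?n. P (vs ! i))" for P
    unfolding vs(2)[symmetric] by (metis in_set_conv_nth)
  have ex_eq: "(\<exists>u\<in>verts G. P u) \<longleftrightarrow> (\<exists>i<?n. P (vs ! i))" for P
    unfolding vs(2)[symmetric] by (metis in_set_conv_nth)
  have mult: "(adjacency_mat G vs *\<^sub>v y) $ i = (\<Sum>j = 0..<?n. ?a (vs ! i) (vs ! j) * y $ j)"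
    if "y \<in> carrier_vec ?n" "i < ?n" for y i
  proof -
    have d: "dim_vec y = ?n" using that(1) by (rule carrier_vecD)
    have "(adjacency_mat G vs *\<^sub>v y) $ i = row (adjacency_mat G vs) i \<bullet> y"
      using that(2) by (intro index_mult_mat_vec) (simp add: adjacency_mat_def)
    also have "\<dots> = (\<Sum>j = 0..<?n. row (adjacency_mat G vs) i $ j * y $ j)"
      by (simp only: scalar_prod_def d)
    also have "\<dots> = (\<Sum>j = 0..<?n. ?a (vs ! i) (vs ! j) * y $ j)"
    proof (rule sum.cong)
      fix j assume "j \<in> {0..<?n}"
      then have "row (adjacency_mat G vs) i $ j = ?a (vs ! i) (vs ! j)"
        using that(2) by (simp add: adjacency_mat_def)
      then show "row (adjacency_mat G vs) i $ j * y $ j = ?a (vs ! i) (vs ! j) * y $ j"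
        by (rule arg_cong)
    qed (rule refl)
    finally show ?thesis .
  qed
  have vec_iff: "eigenvector (adjacency_mat G vs) y k \<longleftrightarrow> y \<in> carrier_vec ?n \<and>
      (\<exists>i<?n. y $ i \<noteq> 0) \<and>
      (\<forall>i<?n. (\<Sum>j = 0..<?n. ?a (vs ! i) (vs ! j) * y $ j) = k * y $ i)" for y
  proof (cases "y \<in> carrier_vec ?n")
    case True
    have dims: "dim_row (adjacency_mat G vs) = ?n" "dim_vec y = ?n"
      using True by (simp_all add: adjacency_mat_def)
    have "y \<noteq> 0\<^sub>v ?n \<longleftrightarrow> (\<exists>i<?n. y $ i \<noteq> 0)"
      using dims(2) by (auto simp: vec_eq_iff)
    moreover have "adjacency_mat G vs *\<^sub>v y = k \<cdot>\<^sub>v y \<longleftrightarrow>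
        (\<forall>i<?n. (adjacency_mat G vs *\<^sub>v y) $ i = k * y $ i)"
      using dims by (simp add: vec_eq_iff)
    ultimately show ?thesis
      using True mult[OF True] by (simp add: eigenvector_def dims(1))
  next
    case False
    then show ?thesis by (simp add: eigenvector_def adjacency_mat_def)
  qed
  show ?thesis
  proof
    assume ?L
    then obtain y where "eigenvector (adjacency_mat G vs) y k"
      by (auto simp: eigenvalue_def)
    note y = this[unfolded vec_iff]
    define x where "x v = y $ (the_inv_into {0..<?n} (\<lambda>i. vs ! i) v)" for v
    have x: "x (vs ! i) = y $ i" if "i < ?n" for i
      using the_inv_into_f_f[OF bij_betw_imp_inj_on[OF bij]] that by (simp add: x_def)
    show ?R
      unfolding all_eq ex_eq sum_eq using y by (intro exI[of _ x]) (auto simp: x)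
  next
    assume ?R
    then obtain x where x: "\<exists>i<?n. x (vs ! i) \<noteq> 0"
      "\<forall>i<?n. (\<Sum>j = 0..<?n. ?a (vs ! i) (vs ! j) * x (vs ! j)) = k * x (vs ! i)"
      unfolding all_eq ex_eq sum_eq by blast
    have "eigenvector (adjacency_mat G vs) (vec ?n (\<lambda>i. x (vs ! i))) k"
      unfolding vec_iff using x by auto
    then show ?L
      by (auto simp: eigenvalue_def)
  qed
qed

end

theory Submission
  imports
    Defs
    "HOL-Analysis.Function_Topology"
    "Jordan_Normal_Form.Spectral_Radius"
begin

text \<open>
  Let \<open>x\<close> be a positive eigenvector of \<open>G\<close> for its largest eigenvalue \<open>\<rho>\<close> (Perron--Frobenius),
  and let \<open>\<sigma>\<close> and \<open>\<beta>\<close> be the sums of its entries over \<open>S\<close> and over \<open>B\<close>.  Every vertex of \<open>S\<close>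
  sees exactly \<open>B\<close> outside \<open>S\<close>, so adding the eigenvalue equations over \<open>S\<close> gives
  \<open>(\<rho> - n\<^sub>1) * \<sigma> = card S * \<beta>\<close>.  Conversely a vertex of \<open>H\<close> sees either all of \<open>S\<close> or nothing of
  it, so on \<open>H\<close> the equation reads \<open>\<rho> x = \<sigma> 1\<^sub>B + A x\<close>, where \<open>A\<close> is the adjacency matrix of \<open>H\<close>
  and \<open>1\<^sub>B\<close> the indicator of \<open>B\<close>.  Solving formally by a Neumann series, \<open>x\<close> is
  \<open>\<sigma> / \<rho>\<close> times the sum over \<open>l\<close> of \<open>A\<^sup>l 1\<^sub>B / \<rho>\<^sup>l\<close>; the entries of
  \<open>A\<^sup>l 1\<^sub>B\<close> count the \<open>l\<close>-walks that end in \<open>B\<close>.  Summing over \<open>B\<close> yields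
  \<open>\<beta> = \<sigma> / \<rho> * (\<Sum>l. W l / \<rho>\<^sup>l)\<close>, where \<open>W 0 = card B\<close>, and eliminating \<open>\<sigma> / \<beta>\<close> between the two
  relations is the claim.

  The series converges because everything is nonnegative: iterating the equation on \<open>H\<close> bounds
  its partial sums at each vertex by \<open>\<rho> / \<sigma>\<close> times the entry of \<open>x\<close> there.  Pairing the
  equation with \<open>A\<^sup>l 1\<^sub>B\<close> then makes the series over \<open>B\<close> telescope
  (lemma \<open>walk_series_sums\<close>).

  The Perron vector comes from the variational principle.  The quadratic form of a nonnegative
  symmetric matrix attains its maximum on the nonnegative part of the unit sphere, a
  maximiser there is a maximiser on the whole sphere because passing to absolute values does not
  decrease the form, and maximisers are eigenvectors.  Connectedness makes the vector positive
  (lemma \<open>obtain_perron_vector\<close>).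
\<close>

section \<open>Largest eigenvalue of a nonnegative symmetric matrix\<close>

text \<open>
  The form \<open>P\<close> of \<open>\<mu> I - a\<close> is positive semidefinite and vanishes at \<open>x\<close>.  With
  \<open>r = (\<mu> I - a) x\<close>, moving from \<open>x\<close> a distance \<open>t\<close> against \<open>r\<close> changes \<open>P\<close> by
  \<open>- 2 t \<parallel>r\<parallel>\<^sup>2\<close> up to a term of order \<open>t\<^sup>2\<close>; for small \<open>t\<close> this would be negative unless \<open>r = 0\<close>.
\<close>

lemma rayleigh_maximiser_is_eigenvector:
  fixes a :: "'a \<Rightarrow> 'a \<Rightarrow> real"
  assumes sym: "\<And>u v. a u v = a v u"
    and bound: "\<And>y. (\<Sum>u\<in>V. \<Sum>v\<in>V. a u v * y u * y v) \<le> \<mu> * (\<Sum>u\<in>V. (y u)\<^sup>2)"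
    and attained: "(\<Sum>u\<in>V. \<Sum>v\<in>V. a u v * x u * x v) = \<mu> * (\<Sum>u\<in>V. (x u)\<^sup>2)"
    and "finite V" "u \<in> V"
  shows "(\<Sum>v\<in>V. a u v * x v) = \<mu> * x u"
proof -
  define P where "P y z = \<mu> * (\<Sum>u\<in>V. y u * z u) - (\<Sum>u\<in>V. \<Sum>v\<in>V. a u v * y u * z v)"
    for y z :: "'a \<Rightarrow> real"
  define r where "r u = \<mu> * x u - (\<Sum>v\<in>V. a u v * x v)" for u
  have P_nonneg: "P y y \<ge> 0" for y
    using bound[of y] by (simp add: P_def power2_eq_square)
  have P_sym: "P y z = P z y" for y z
  proof -
    have "(\<Sum>u\<in>V. \<Sum>v\<in>V. a u v * y u * z v) = (\<Sum>v\<in>V. \<Sum>u\<in>V. a u v * y u * z v)"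
      by (rule sum.swap)
    also have "\<dots> = (\<Sum>v\<in>V. \<Sum>u\<in>V. a v u * z v * y u)"
      by (intro sum.cong refl) (simp add: sym mult_ac)
    finally show ?thesis by (simp add: P_def mult.commute)
  qed
  have P_x: "P y x = (\<Sum>u\<in>V. y u * r u)" for y
    by (simp add: P_def r_def algebra_simps sum_subtractf sum_distrib_left)
  have P_xx: "P x x = 0"
    using attained by (simp add: P_def power2_eq_square)
  have expand: "P (\<lambda>u. x u - t * r u) (\<lambda>u. x u - t * r u) = P x x - t * P r x - t * P x r + t\<^sup>2 * P r r" for t
    by (simp add: P_def algebra_simps sum_subtractf sum.distrib sum_distrib_left power2_eq_square)
  define R where "R = (\<Sum>u\<in>V. (r u)\<^sup>2)"
  have PR: "P r x = R" "P x r = R"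
    using P_sym[of x r] by (simp_all add: P_x R_def power2_eq_square)
  have quadratic: "2 * (t * R) \<le> t\<^sup>2 * P r r" for t
    using P_nonneg[of "\<lambda>u. x u - t * r u"] expand[of t] P_xx PR by (simp add: mult.commute)
  have "R \<le> 0"
  proof -
    define t where "t = 1 / (1 + P r r)"
    have t: "t > 0" "t * P r r < 1"
      using P_nonneg[of r] by (auto simp: t_def field_simps)
    \<comment> \<open>The step is scaled by \<open>R\<close> so that both sides carry the nonnegative factor \<open>R\<^sup>2\<close>.\<close>
    have "2 * (t * R\<^sup>2) \<le> t * R\<^sup>2 * (t * P r r)"
      using quadratic[of "R * t"] by (simp add: power2_eq_square mult_ac)
    also have "\<dots> \<le> t * R\<^sup>2 * 1"
      using t by (intro mult_left_mono) auto
    finally have "t * R\<^sup>2 \<le> 0" by simp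
    then show ?thesis using t by (simp add: mult_le_0_iff)
  qed
  then have "r u = 0"
    using assms(4,5) sum_nonneg_eq_0_iff[of V "\<lambda>u. (r u)\<^sup>2"] sum_nonneg[of V "\<lambda>u. (r u)\<^sup>2"]
    by (simp add: R_def)
  then show ?thesis by (simp add: r_def)
qed

text \<open>
  The last conclusion, that \<open>\<mu>\<close> bounds the Rayleigh quotient of every vector, is what identifies
  \<open>\<mu>\<close> as the largest eigenvalue.
\<close>

lemma nonneg_symmetric_has_nonneg_eigenvector:
  fixes a :: "'a \<Rightarrow> 'a \<Rightarrow> real"
  assumes fin: "finite V" and ne: "V \<noteq> {}"
    and sym: "\<And>u v. a u v = a v u" and nonneg: "\<And>u v. a u v \<ge> 0"
  obtains x \<mu> where "\<And>v. x v \<ge> 0" "\<exists>v\<in>V. x v \<noteq> 0"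
    "\<And>u. u \<in> V \<Longrightarrow> (\<Sum>v\<in>V. a u v * x v) = \<mu> * x u"
    "\<And>y. (\<Sum>u\<in>V. \<Sum>v\<in>V. a u v * y u * y v) \<le> \<mu> * (\<Sum>u\<in>V. (y u)\<^sup>2)"
proof -
  define q where "q y = (\<Sum>u\<in>V. \<Sum>v\<in>V. a u v * y u * y v)" for y :: "'a \<Rightarrow> real"
  define sq where "sq y = (\<Sum>u\<in>V. (y u)\<^sup>2)" for y :: "'a \<Rightarrow> real"
  \<comment> \<open>Vectors are functions on the whole type.  Freezing them at zero outside \<open>V\<close> makes the
    nonnegative unit sphere a closed subset of a product of compact sets.\<close>
  define C where "C = (\<Pi>\<^sub>E v\<in>UNIV. if v \<in> V then {0..1::real} else {0})"
  define K where "K = C \<inter> {x. sq x = 1}"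
  have "compactin (product_topology (\<lambda>_. euclidean) UNIV) C"
    unfolding C_def compactin_PiE by (auto simp: compactin_euclidean_iff)
  then have "compact C"
    by (simp add: euclidean_product_topology compactin_euclidean_iff)
  moreover have cont_sq: "continuous_on UNIV sq"
    unfolding sq_def by (intro continuous_intros continuous_on_product_coordinates)
  then have "closed {x. sq x = 1}"
    by (intro closed_Collect_eq continuous_on_const)
  ultimately have "compact K" unfolding K_def by (rule compact_Int_closed)
  moreover have "continuous_on K q"
    unfolding q_def
    by (intro continuous_intros continuous_on_subset[OF continuous_on_product_coordinates]) auto
  moreover have normalise: "(\<lambda>u. if u \<in> V then \<bar>y u\<bar> / sqrt (sq y) else 0) \<in> K" if "sq y > 0" for y
  proof -
    have "\<bar>y u\<bar> \<le> sqrt (sq y)" if "u \<in> V" for u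
    proof -
      have "(y u)\<^sup>2 \<le> sq y" unfolding sq_def using fin that by (intro member_le_sum) auto
      then show ?thesis by (metis real_sqrt_abs real_sqrt_le_mono)
    qed
    moreover have "sq (\<lambda>u. if u \<in> V then \<bar>y u\<bar> / sqrt (sq y) else 0) = 1"
    proof -
      have "sq (\<lambda>u. if u \<in> V then \<bar>y u\<bar> / sqrt (sq y) else 0) = (\<Sum>u\<in>V. (y u)\<^sup>2 / sq y)"
        unfolding sq_def[of "\<lambda>u. if u \<in> V then \<bar>y u\<bar> / sqrt (sq y) else 0"]
        using \<open>sq y > 0\<close> by (intro sum.cong) (auto simp: power_divide)
      also have "\<dots> = 1" using \<open>sq y > 0\<close> by (simp add: sum_divide_distrib[symmetric] sq_def)
      finally show ?thesis .
    qed
    ultimately show ?thesis using \<open>sq y > 0\<close> by (auto simp: K_def C_def)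
  qed
  moreover have "K \<noteq> {}"
  proof -
    have "sq (\<lambda>_. 1) > 0" using fin ne by (simp add: sq_def card_gt_0_iff)
    from normalise[OF this] show ?thesis by blast
  qed
  ultimately obtain x where x: "x \<in> K" and max: "\<And>y. y \<in> K \<Longrightarrow> q y \<le> q x"
    using continuous_attains_sup[of K q] by metis
  have sqx: "sq x = 1" using x by (simp add: K_def)
  have x_nonneg: "x v \<ge> 0" for v
    using x by (auto simp: K_def C_def PiE_iff split: if_splits dest!: spec[of _ v])
  have bound: "q y \<le> q x * sq y" for y
  proof (cases "sq y = 0")
    case True
    then have "\<forall>u\<in>V. y u = 0" using fin by (simp add: sq_def sum_nonneg_eq_0_iff)
    then show ?thesis using True by (simp add: q_def)
  next
    case False
    then have pos: "sq y > 0"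
      using sum_nonneg[of V "\<lambda>u. (y u)\<^sup>2"] by (simp add: sq_def)
    let ?z = "\<lambda>u. if u \<in> V then \<bar>y u\<bar> / sqrt (sq y) else 0"
    have "q y \<le> (\<Sum>u\<in>V. \<Sum>v\<in>V. a u v * \<bar>y u\<bar> * \<bar>y v\<bar>)"
    proof -
      have "a u v * y u * y v \<le> a u v * \<bar>y u\<bar> * \<bar>y v\<bar>" for u v
        using abs_ge_self[of "a u v * y u * y v"] nonneg[of u v] by (simp add: abs_mult)
      then show ?thesis unfolding q_def by (intro sum_mono)
    qed
    also have "\<dots> = sq y * q ?z"
    proof -
      have "q ?z = (\<Sum>u\<in>V. \<Sum>v\<in>V. a u v * \<bar>y u\<bar> * \<bar>y v\<bar> / sq y)"
        unfolding q_def using pos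
        by (intro sum.cong refl) (simp add: power2_eq_square[symmetric])
      also have "\<dots> = (\<Sum>u\<in>V. \<Sum>v\<in>V. a u v * \<bar>y u\<bar> * \<bar>y v\<bar>) / sq y"
        by (simp add: sum_divide_distrib)
      finally show ?thesis using pos by simp
    qed
    also have "\<dots> \<le> sq y * q x"
      using max[OF normalise[OF pos]] pos by (intro mult_left_mono) auto
    finally show ?thesis by (simp add: mult.commute)
  qed
  show thesis
  proof (rule that[of x "q x"])
    show "\<exists>v\<in>V. x v \<noteq> 0" using sqx by (auto simp: sq_def intro: ccontr)
    show "(\<Sum>u\<in>V. \<Sum>v\<in>V. a u v * y u * y v) \<le> q x * (\<Sum>u\<in>V. (y u)\<^sup>2)" for y
      using bound[of y] by (simp add: q_def sq_def)
    then show "(\<Sum>v\<in>V. a u v * x v) = q x * x u" if "u \<in> V" for u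
      using sqx that fin
      by (intro rayleigh_maximiser_is_eigenvector[of a V] sym) (auto simp: q_def sq_def)
  qed (rule x_nonneg)
qed

section \<open>Perron vector of a connected graph\<close>

definition adjacency :: "('a, 'b) pre_digraph \<Rightarrow> 'a \<Rightarrow> 'a \<Rightarrow> real" where
  "adjacency G u v = (if (u, v) \<in> arcs_ends G then 1 else 0)"

lemma adjacency_nonneg: "adjacency G u v \<ge> 0"
  by (simp add: adjacency_def)

lemma adjacency_commute: "Digraph.graph G \<Longrightarrow> adjacency G u v = adjacency G v u"
  using arcs_ends_symmetric[of G] sym_digraph.sym_arcs[of G]
  by (auto simp: adjacency_def Digraph.graph_def pseudo_graph_def)

text \<open>
  The form in which connectedness is used: once to spread a zero of the Perron vector over the
  graph, once to find an edge between \<open>S\<close> and its complement.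
\<close>

lemma connected_closed_set_eq_verts:
  assumes G: "Digraph.graph G" "Digraph_Component.connected G"
    and U: "U \<subseteq> verts G" "U \<noteq> {}"
    and closed: "\<And>u v. u \<in> U \<Longrightarrow> (u, v) \<in> arcs_ends G \<Longrightarrow> v \<in> U"
  shows "U = verts G"
proof
  interpret Digraph.graph G by fact
  obtain u where u: "u \<in> U" using U by blast
  have sc: "strongly_connected G"
    using symmetric_connected_imp_strongly_connected[OF sym_arcs G(2)] .
  show "verts G \<subseteq> U"
  proof
    fix v assume "v \<in> verts G"
    then have "u \<rightarrow>\<^sup>*\<^bsub>G\<^esub> v" using sc u U(1) by (auto simp: strongly_connected_def)
    then show "v \<in> U" using u by (induct rule: reachable_induct) (auto intro: closed)
  qed
qed fact

lemma obtain_perron_vector: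
  assumes G: "Digraph.graph G" "Digraph_Component.connected G"
  obtains x where "\<And>v. v \<in> verts G \<Longrightarrow> x v > 0"
    "\<And>u. u \<in> verts G \<Longrightarrow> (\<Sum>v\<in>verts G. adjacency G u v * x v) = graph_spectral_radius G * x u"
proof -
  interpret Digraph.graph G by fact
  have ne: "verts G \<noteq> {}" using G(2) by (simp add: connected_conv)
  obtain x \<mu> where x: "\<And>v. x v \<ge> 0" "\<exists>v\<in>verts G. x v \<noteq> 0"
    and eig: "\<And>u. u \<in> verts G \<Longrightarrow> (\<Sum>v\<in>verts G. adjacency G u v * x v) = \<mu> * x u"
    and bound: "\<And>y. (\<Sum>u\<in>verts G. \<Sum>v\<in>verts G. adjacency G u v * y u * y v)
      \<le> \<mu> * (\<Sum>u\<in>verts G. (y u)\<^sup>2)"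
    by (rule nonneg_symmetric_has_nonneg_eigenvector[of "verts G" "adjacency G",
        OF finite_verts ne adjacency_commute[OF G(1)] adjacency_nonneg]) (rule that)
  define vs where "vs = (SOME vs. distinct vs \<and> set vs = verts G)"
  have "\<exists>vs. distinct vs \<and> set vs = verts G"
    using finite_distinct_list[OF finite_verts] by blast
  then have "distinct vs \<and> set vs = verts G"
    unfolding vs_def by (rule someI_ex)
  then have vs: "distinct vs" "set vs = verts G" by auto
  let ?E = "{k. eigenvalue (adjacency_mat G vs) k}"
  have fin: "finite ?E"
    using card_finite_spectrum(1)[of "adjacency_mat G vs" "length vs"]
    by (simp add: spectrum_def adjacency_mat_def)
  have "\<mu> \<in> ?E"
    unfolding mem_Collect_eq eigenvalue_adjacency_mat_iff[OF vs]
    using x(2) eig by (intro exI[of _ x]) (simp add: adjacency_def)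
  moreover have "k \<le> \<mu>" if "k \<in> ?E" for k
  proof -
    from that obtain y where y: "\<exists>v\<in>verts G. y v \<noteq> 0"
      "\<And>u. u \<in> verts G \<Longrightarrow> (\<Sum>v\<in>verts G. adjacency G u v * y v) = k * y u"
      unfolding mem_Collect_eq eigenvalue_adjacency_mat_iff[OF vs] by (auto simp: adjacency_def)
    have "k * (\<Sum>u\<in>verts G. (y u)\<^sup>2) = (\<Sum>u\<in>verts G. y u * (\<Sum>v\<in>verts G. adjacency G u v * y v))"
      unfolding sum_distrib_left[of k]
      by (intro sum.cong refl) (simp add: y(2) power2_eq_square)
    also have "\<dots> \<le> \<mu> * (\<Sum>u\<in>verts G. (y u)\<^sup>2)"
      using bound[of y] by (simp add: sum_distrib_left mult_ac)
    finally have "k * (\<Sum>u\<in>verts G. (y u)\<^sup>2) \<le> \<mu> * (\<Sum>u\<in>verts G. (y u)\<^sup>2)" .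
    moreover have "(\<Sum>u\<in>verts G. (y u)\<^sup>2) > 0"
      using y(1) finite_verts by (auto intro: sum_pos2)
    ultimately show ?thesis by simp
  qed
  ultimately have rad: "graph_spectral_radius G = \<mu>"
    unfolding graph_spectral_radius_def vs_def[symmetric]
    using fin by (intro Max_eqI) auto
  \<comment> \<open>At a zero of \<open>x\<close> the eigenvalue equation is a vanishing sum of nonnegative terms, so \<open>x\<close>
    also vanishes at all neighbours.\<close>
  have "{v \<in> verts G. x v = 0} = {}"
  proof (rule ccontr)
    assume "{v \<in> verts G. x v = 0} \<noteq> {}"
    then have "{v \<in> verts G. x v = 0} = verts G"
    proof (intro connected_closed_set_eq_verts[OF G])
      fix u v assume u: "u \<in> {v \<in> verts G. x v = 0}" and uv: "(u, v) \<in> arcs_ends G"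
      have v: "v \<in> verts G" using uv by (auto simp: arcs_ends_conv)
      have "(\<Sum>v\<in>verts G. adjacency G u v * x v) = 0" using eig u by simp
      then have "adjacency G u v * x v = 0"
        using sum_nonneg_eq_0_iff[of "verts G" "\<lambda>v. adjacency G u v * x v"] v x(1)
        by (auto simp: adjacency_nonneg)
      then show "v \<in> {v \<in> verts G. x v = 0}" using uv v by (simp add: adjacency_def)
    qed auto
    then show False using x(2) by blast
  qed
  then have pos: "x v > 0" if "v \<in> verts G" for v
    using x(1)[of v] that by fastforce
  show thesis
    using that[of x, OF pos] eig unfolding rad by blast
qed

section \<open>Counting walks\<close>

lemma finite_vwalks_of_length:
  assumes "finite (verts H)"
  shows "finite {p. vwalk p H \<and> vwalk_length p = l \<and> hd p = u \<and> last p \<in> B}"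
proof (rule finite_subset)
  show "finite {p. set p \<subseteq> verts H \<and> length p \<le> Suc l}"
    by (rule finite_lists_length_le[OF assms])
qed (auto simp: vwalk_def)

lemma num_walks_0:
  assumes "u \<in> verts H"
  shows "num_walks H B 0 u = (if u \<in> B then 1 else 0)"
proof -
  have "{p. vwalk p H \<and> vwalk_length p = 0 \<and> hd p = u \<and> last p \<in> B}
    = (if u \<in> B then {[u]} else {})"
    using assms by (auto simp: vwalk_def length_Suc_conv le_Suc_eq)
  then show ?thesis by (simp add: num_walks_def)
qed

lemma num_walks_Suc:
  assumes "finite (verts H)" "u \<in> verts H"
  shows "num_walks H B (Suc l) u = (\<Sum>v | v \<in> verts H \<and> (u, v) \<in> arcs_ends H. num_walks H B l v)"
proof -
  let ?W = "\<lambda>l u. {p. vwalk p H \<and> vwalk_length p = l \<and> hd p = u \<and> last p \<in> B}"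
  let ?N = "{v. v \<in> verts H \<and> (u, v) \<in> arcs_ends H}"
  have "?W (Suc l) u = (\<Union>v\<in>?N. (#) u ` ?W l v)" (is "?L = ?R")
  proof (intro Set.set_eqI iffI)
    fix p assume p: "p \<in> ?L"
    then obtain q where q: "p = u # q" "length q = Suc l"
      by (cases p) (auto simp: vwalk_def)
    then have "q \<noteq> []" by auto
    then show "p \<in> ?R"
      using p q by (intro UN_I[of "hd q"]) (auto simp: vwalk_def)
  next
    fix p assume "p \<in> ?R"
    then show "p \<in> ?L"
      using assms(2) by (auto simp: vwalk_def Suc_diff_le le_simps)
  qed
  then have "num_walks H B (Suc l) u = card (\<Union>v\<in>?N. (#) u ` ?W l v)"
    by (simp add: num_walks_def)
  also have "\<dots> = (\<Sum>v\<in>?N. card ((#) u ` ?W l v))"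
    using assms finite_vwalks_of_length[OF assms(1)] by (intro card_UN_disjoint) auto
  also have "\<dots> = (\<Sum>v\<in>?N. num_walks H B l v)"
    by (simp add: num_walks_def card_image)
  finally show ?thesis .
qed

text \<open>
  The walk counts are the entries of the powers of the adjacency matrix applied to the indicator
  of \<open>B\<close>.
\<close>

lemma num_walks_Suc_adjacency:
  assumes "finite (verts H)" "u \<in> verts H"
  shows "real (num_walks H B (Suc l) u) = (\<Sum>v\<in>verts H. adjacency H u v * real (num_walks H B l v))"
proof -
  have "(\<Sum>v\<in>verts H. adjacency H u v * real (num_walks H B l v))
    = (\<Sum>v\<in>verts H. if (u, v) \<in> arcs_ends H then real (num_walks H B l v) else 0)"
    by (intro sum.cong) (auto simp: adjacency_def)
  then show ?thesis
    using assms by (simp add: num_walks_Suc sum.inter_filter if_distrib cong: if_cong)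
qed

section \<open>Generating function of the walks\<close>

text \<open>
  Here \<open>w l\<close> is \<open>A\<^sup>l 1\<^sub>B\<close> for the matrix \<open>A\<close> with entries \<open>a\<close>, and \<open>x\<close> solves
  \<open>\<rho> x = c 1\<^sub>B + A x\<close>.  Pairing this equation with \<open>w l\<close> and moving the symmetric \<open>A\<close> to the other
  side gives \<open>\<rho> \<langle>w l, x\<rangle> = c * (\<Sum>u\<in>B. w l u) + \<langle>w (Suc l), x\<rangle>\<close>.  So the series telescopes
  along \<open>p l = \<langle>w l, x\<rangle> / \<rho>\<^sup>l\<close>, from \<open>p 0 = (\<Sum>u\<in>B. x u)\<close> down to the limit of \<open>p\<close>.  That limit
  is zero because \<open>w l u / \<rho>\<^sup>l\<close> is summable for each \<open>u\<close>.
\<close>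

lemma walk_series_sums:
  fixes a :: "'a \<Rightarrow> 'a \<Rightarrow> real" and w :: "nat \<Rightarrow> 'a \<Rightarrow> real"
  assumes fin: "finite U" and B: "B \<subseteq> U"
    and sym: "\<And>u v. u \<in> U \<Longrightarrow> v \<in> U \<Longrightarrow> a u v = a v u" and nonneg: "\<And>u v. a u v \<ge> 0"
    and pos: "c > 0" "\<rho> > 0" and x: "\<And>u. u \<in> U \<Longrightarrow> x u \<ge> 0"
    and eq: "\<And>u. u \<in> U \<Longrightarrow> \<rho> * x u = c * w 0 u + (\<Sum>v\<in>U. a u v * x v)"
    and w_0: "\<And>u. u \<in> U \<Longrightarrow> w 0 u = (if u \<in> B then 1 else 0)"
    and w_Suc: "\<And>l u. u \<in> U \<Longrightarrow> w (Suc l) u = (\<Sum>v\<in>U. a u v * w l v)"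
  shows "(\<lambda>l. (\<Sum>u\<in>B. w l u) / \<rho> ^ l) sums (\<rho> / c * (\<Sum>u\<in>B. x u))"
proof -
  have w_nonneg: "u \<in> U \<Longrightarrow> w l u \<ge> 0" for l u
    by (induction l arbitrary: u) (auto simp: w_0 w_Suc intro!: sum_nonneg mult_nonneg_nonneg nonneg)
  \<comment> \<open>Each substitution of the equation into itself produces one more term of the Neumann series
    and a nonnegative remainder, which is discarded.\<close>
  have partial: "c / \<rho> * (\<Sum>l<N. w l u / \<rho> ^ l) \<le> x u" if "u \<in> U" for u N
    using that
  proof (induction N arbitrary: u)
    case (Suc N)
    have "c * (\<Sum>l<Suc N. w l u / \<rho> ^ l)
        = c * w 0 u + c * (\<Sum>l<N. \<Sum>v\<in>U. a u v * w l v / (\<rho> * \<rho> ^ l))"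
      using Suc.prems
      by (subst sum.lessThan_Suc_shift) (simp add: w_Suc sum_divide_distrib algebra_simps)
    also have "\<dots> = c * w 0 u + c * (\<Sum>v\<in>U. \<Sum>l<N. a u v * w l v / (\<rho> * \<rho> ^ l))"
      by (subst sum.swap) simp
    also have "\<dots> = c * w 0 u + (\<Sum>v\<in>U. a u v * (c / \<rho> * (\<Sum>l<N. w l v / \<rho> ^ l)))"
      by (simp add: sum_distrib_left mult_ac)
    also have "\<dots> \<le> c * w 0 u + (\<Sum>v\<in>U. a u v * x v)"
      by (intro add_left_mono sum_mono mult_left_mono Suc.IH nonneg)
    also have "\<dots> = \<rho> * x u" using eq Suc.prems by simp
    finally show ?case using pos(2) by (simp add: field_simps)
  qed (simp add: x)
  have vanish: "(\<lambda>l. w l u / \<rho> ^ l) \<longlonglongrightarrow> 0" if "u \<in> U" for u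
  proof (rule summable_LIMSEQ_zero, rule summableI_nonneg_bounded)
    show "(\<Sum>l<N. w l u / \<rho> ^ l) \<le> \<rho> / c * x u" for N
      using partial[OF that, of N] pos by (simp add: field_simps)
    show "0 \<le> w l u / \<rho> ^ l" for l using w_nonneg that pos by simp
  qed
  define p where "p l = (\<Sum>u\<in>U. w l u * x u) / \<rho> ^ l" for l
  have "p \<longlonglongrightarrow> (\<Sum>u\<in>U. 0 * x u)"
    unfolding p_def sum_divide_distrib times_divide_eq_left[symmetric]
    by (intro tendsto_sum tendsto_mult tendsto_const) (simp add: vanish)
  then have "p \<longlonglongrightarrow> 0" by simp
  from telescope_sums'[OF this] have "(\<lambda>l. \<rho> / c * (p l - p (Suc l))) sums (\<rho> / c * p 0)"
    using sums_mult by fastforce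
  moreover have "\<rho> / c * (p l - p (Suc l)) = (\<Sum>u\<in>B. w l u) / \<rho> ^ l" for l
  proof -
    have "\<rho> * (\<Sum>u\<in>U. w l u * x u) = (\<Sum>u\<in>U. w l u * (\<rho> * x u))"
      by (simp add: sum_distrib_left mult_ac)
    also have "\<dots> = (\<Sum>u\<in>U. w l u * (c * w 0 u + (\<Sum>v\<in>U. a u v * x v)))"
      by (simp add: eq)
    also have "\<dots> = c * (\<Sum>u\<in>U. w l u * w 0 u) + (\<Sum>u\<in>U. \<Sum>v\<in>U. w l u * (a u v * x v))"
      by (simp add: algebra_simps sum.distrib sum_distrib_left)
    also have "(\<Sum>u\<in>U. w l u * w 0 u) = (\<Sum>u\<in>U. if u \<in> B then w l u else 0)"
      by (intro sum.cong) (auto simp: w_0)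
    also have "\<dots> = (\<Sum>u\<in>B. w l u)"
      using fin B by (simp add: sum.If_cases Int_absorb1)
    also have "(\<Sum>u\<in>U. \<Sum>v\<in>U. w l u * (a u v * x v)) = (\<Sum>v\<in>U. \<Sum>u\<in>U. w l u * (a u v * x v))"
      by (rule sum.swap)
    also have "\<dots> = (\<Sum>v\<in>U. w (Suc l) v * x v)"
    proof (rule sum.cong[OF refl])
      fix v assume v: "v \<in> U"
      have "(\<Sum>u\<in>U. w l u * (a u v * x v)) = (\<Sum>u\<in>U. a v u * w l u * x v)"
        using sym[OF _ v] by (intro sum.cong refl) (simp add: mult_ac)
      then show "(\<Sum>u\<in>U. w l u * (a u v * x v)) = w (Suc l) v * x v"
        by (simp add: w_Suc[OF v] sum_distrib_right)
    qed
    finally show ?thesis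
      using pos by (simp add: p_def field_simps)
  qed
  moreover have "p 0 = (\<Sum>u\<in>B. x u)"
  proof -
    have "p 0 = (\<Sum>u\<in>U. if u \<in> B then x u else 0)"
      unfolding p_def by (auto simp: w_0 intro!: sum.cong)
    then show ?thesis using fin B by (simp add: sum.If_cases Int_absorb1)
  qed
  ultimately show ?thesis by simp
qed

section \<open>Joining a regular graph to the rest\<close>

lemma adjacency_induce_subgraph:
  "adjacency (induce_subgraph G U) u v = (if u \<in> U \<and> v \<in> U then adjacency G u v else 0)"
  by (auto simp: adjacency_def arcs_ends_conv)

text \<open>
  The out-degree counts arcs, the row sum counts neighbours; they agree since parallel arcs are
  excluded.
\<close>

lemma sum_adjacency_eq_out_degree:
  assumes "fin_digraph G" "nomulti_digraph G"
  shows "(\<Sum>v\<in>verts G. adjacency G u v) = real (out_degree G u)"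
proof -
  interpret fin_digraph G by fact
  interpret nomulti_digraph G by fact
  have "{v \<in> verts G. (u, v) \<in> arcs_ends G} = head G ` out_arcs G u"
    by (auto simp: arcs_ends_conv out_arcs_def)
  moreover have "inj_on (head G) (out_arcs G u)"
    using no_multi_arcs by (auto simp: inj_on_def arc_to_ends_def)
  ultimately have "card {v \<in> verts G. (u, v) \<in> arcs_ends G} = out_degree G u"
    by (simp add: out_degree_def card_image)
  moreover have "(\<Sum>v\<in>verts G. adjacency G u v) = real (card {v \<in> verts G. (u, v) \<in> arcs_ends G})"
    by (simp add: adjacency_def sum.inter_filter[symmetric])
  ultimately show ?thesis by simp
qed


theorem theorem1p3:
  fixes G H :: "('a, 'b) pre_digraph"
    and S B T :: "'a set"
    and n n\<^sub>1 :: nat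
    and \<rho> :: real
  assumes "Digraph.graph G" and "Digraph_Component.connected G" and "card (verts G) = n"
    and "S \<subseteq> verts G" and "1 \<le> card S" and "card S < n"
    and "regular_graph (induce_subgraph G S) n\<^sub>1"
    and "verts G - S = B \<union> T"
    and "\<forall>v\<in>B. \<forall>s\<in>S. (v, s) \<in> arcs_ends G"
    and "\<forall>v\<in>T. \<forall>s\<in>S. (v, s) \<notin> arcs_ends G"
    and "H = induce_subgraph G (verts G - S)"
    and "\<rho> = graph_spectral_radius G"
  shows "summable (\<lambda>i. real (total_walks H B (Suc i)) / \<rho> ^ Suc i) \<and>
    real (card S) / (\<rho> * (\<rho> - real n\<^sub>1)) *
      (real (card B) + (\<Sum>i. real (total_walks H B (Suc i)) / \<rho> ^ Suc i)) = 1"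
proof -
  note G = assms(1,2)
  interpret Digraph.graph G by fact
  let ?V = "verts G" and ?U = "verts G - S"
  note adj_sym = adjacency_commute[OF G(1)]
  have S: "finite S" "S \<noteq> {}" using finite_subset[OF assms(4) finite_verts] assms(5) by auto
  have U: "finite ?U" "?U \<noteq> {}" using assms(3,4,6) by auto
  have B: "B \<subseteq> ?U" "finite B" using assms(8) finite_subset[OF _ U(1)] by auto
  obtain x where x_pos: "\<And>v. v \<in> ?V \<Longrightarrow> x v > 0"
    and eig: "\<And>u. u \<in> ?V \<Longrightarrow> (\<Sum>v\<in>?V. adjacency G u v * x v) = \<rho> * x u"
    using obtain_perron_vector[OF G] assms(12) by metis
  define \<sigma> where "\<sigma> = (\<Sum>s\<in>S. x s)"
  define \<beta> where "\<beta> = (\<Sum>b\<in>B. x b)"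
  have split: "(\<Sum>v\<in>?V. f v) = (\<Sum>v\<in>S. f v) + (\<Sum>v\<in>?U. f v)" for f :: "'a \<Rightarrow> real"
    using sum.subset_diff[OF assms(4) finite_verts, of f] by simp
  have cross: "adjacency G v s = (if v \<in> B then 1 else 0)" if "v \<in> ?U" "s \<in> S" for v s
    using that assms(8-10) by (auto simp: adjacency_def)
  have sum_B: "(\<Sum>v\<in>?U. if v \<in> B then f v else 0) = (\<Sum>b\<in>B. f b)" for f :: "'a \<Rightarrow> real"
    using U(1) B(1) by (simp add: sum.If_cases Int_absorb1)
  have "B \<noteq> {}"
  proof
    assume "B = {}"
    then have no_arc: "(s, v) \<notin> arcs_ends G" if "s \<in> S" "v \<in> ?U" for s v
      using cross[OF that(2,1)] adj_sym[of s v] by (auto simp: adjacency_def split: if_splits)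
    have "S = ?V"
    proof (rule connected_closed_set_eq_verts[OF G assms(4) S(2)])
      fix s v assume "s \<in> S" "(s, v) \<in> arcs_ends G"
      moreover from this have "v \<in> ?V" by (auto simp: arcs_ends_conv)
      ultimately show "v \<in> S" using no_arc by blast
    qed
    then show False using U by blast
  qed
  have \<sigma>: "\<sigma> > 0" unfolding \<sigma>_def using S assms(4) x_pos by (intro sum_pos) auto
  have \<beta>: "\<beta> > 0" unfolding \<beta>_def using B \<open>B \<noteq> {}\<close> x_pos by (intro sum_pos) auto
  \<comment> \<open>The eigenvalue equation, seen from the two sides of the cut.\<close>
  have on_S: "\<rho> * x s = (\<Sum>s'\<in>S. adjacency G s s' * x s') + \<beta>" if "s \<in> S" for s
  proof -
    have "(\<Sum>v\<in>?U. adjacency G s v * x v) = (\<Sum>v\<in>?U. if v \<in> B then x v else 0)"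
      using that by (intro sum.cong) (auto simp: adj_sym[of s] cross)
    then show ?thesis using eig[of s] that assms(4) split sum_B[of x] by (auto simp: \<beta>_def)
  qed
  have on_U: "\<rho> * x u = \<sigma> * (if u \<in> B then 1 else 0) + (\<Sum>v\<in>?U. adjacency H u v * x v)"
    if "u \<in> ?U" for u
  proof -
    have "(\<Sum>s\<in>S. adjacency G u s * x s) = \<sigma> * (if u \<in> B then 1 else 0)"
      using that by (simp add: cross \<sigma>_def)
    moreover have "(\<Sum>v\<in>?U. adjacency G u v * x v) = (\<Sum>v\<in>?U. adjacency H u v * x v)"
      using that by (simp add: assms(11) adjacency_induce_subgraph)
    ultimately show ?thesis using eig[of u] that split by auto
  qed
  have regular: "(\<Sum>s\<in>S. adjacency G s s') = real n\<^sub>1" if "s' \<in> S" for s'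
  proof -
    let ?GS = "induce_subgraph G S"
    have "fin_digraph ?GS"
      using wellformed_induce_subgraph[of S] S(1)
      by (auto intro!: wf_digraph.fin_digraphI)
    moreover have "nomulti_digraph ?GS"
      using wellformed_induce_subgraph[of S] no_multi_arcs
      by (auto simp: nomulti_digraph_def nomulti_digraph_axioms_def)
    ultimately have "(\<Sum>s\<in>S. adjacency ?GS s' s) = real n\<^sub>1"
      using sum_adjacency_eq_out_degree[of ?GS s'] that assms(7) by (simp add: regular_graph_def)
    then show ?thesis using that by (simp add: adjacency_induce_subgraph adj_sym[of _ s'])
  qed
  \<comment> \<open>Summing over \<open>S\<close>: each entry inside \<open>S\<close> is counted once per neighbour in \<open>S\<close>.\<close>
  have balance: "(\<rho> - real n\<^sub>1) * \<sigma> = real (card S) * \<beta>"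
  proof -
    have "\<rho> * \<sigma> = (\<Sum>s\<in>S. \<Sum>s'\<in>S. adjacency G s s' * x s') + real (card S) * \<beta>"
      using on_S by (simp add: \<sigma>_def sum_distrib_left sum.distrib)
    also have "(\<Sum>s\<in>S. \<Sum>s'\<in>S. adjacency G s s' * x s')
        = (\<Sum>s'\<in>S. (\<Sum>s\<in>S. adjacency G s s') * x s')"
      by (subst sum.swap) (simp add: sum_distrib_right)
    also have "\<dots> = real n\<^sub>1 * \<sigma>"
      using regular by (simp add: \<sigma>_def sum_distrib_left)
    finally show ?thesis by (simp add: algebra_simps)
  qed
  \<comment> \<open>Positivity of the Perron vector excludes the two degenerate denominators \<open>\<rho> = n\<^sub>1\<close> and
    \<open>\<rho> = 0\<close>.\<close>
  have card_S: "real (card S) > 0" using assms(5) by simp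
  have "(\<rho> - real n\<^sub>1) * \<sigma> > 0" using balance card_S \<beta> by simp
  then have gap: "\<rho> - real n\<^sub>1 > 0" using \<sigma> by (simp add: zero_less_mult_iff)
  then have \<rho>: "\<rho> > 0" using of_nat_0_le_iff[of n\<^sub>1, where 'a = real] by linarith
  have verts_H: "verts H = ?U" by (simp add: assms(11))
  have "(\<lambda>l. (\<Sum>u\<in>B. real (num_walks H B l u)) / \<rho> ^ l) sums (\<rho> / \<sigma> * (\<Sum>u\<in>B. x u))"
  proof (rule walk_series_sums[OF U(1) B(1), where a = "adjacency H"])
    show "adjacency H u v = adjacency H v u" for u v
      by (simp add: assms(11) adjacency_induce_subgraph adj_sym[of u v])
    show "real (num_walks H B 0 u) = (if u \<in> B then 1 else 0)" if "u \<in> ?U" for u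
      using that by (simp add: num_walks_0 verts_H)
    then show "\<rho> * x u = \<sigma> * real (num_walks H B 0 u) + (\<Sum>v\<in>?U. adjacency H u v * x v)"
      if "u \<in> ?U" for u using that on_U by simp
    show "real (num_walks H B (Suc l) u) = (\<Sum>v\<in>?U. adjacency H u v * real (num_walks H B l v))"
      if "u \<in> ?U" for l u using that num_walks_Suc_adjacency[of H u] U(1) by (simp add: verts_H)
  qed (use \<sigma> \<rho> x_pos in \<open>auto simp: adjacency_nonneg less_imp_le\<close>)
  then have sums: "(\<lambda>l. real (total_walks H B l) / \<rho> ^ l) sums (\<rho> / \<sigma> * \<beta>)"
    by (simp add: total_walks_def \<beta>_def)
  have W_0: "total_walks H B 0 = card B"
    using B by (simp add: total_walks_def num_walks_0 verts_H subset_iff)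
  from sums have tail: "(\<lambda>i. real (total_walks H B (Suc i)) / \<rho> ^ Suc i) sums (\<rho> / \<sigma> * \<beta> - real (card B))"
    by (subst sums_Suc_iff) (simp add: W_0)
  have "real (card S) / (\<rho> * (\<rho> - real n\<^sub>1)) * (\<rho> / \<sigma> * \<beta>)
      = (real (card S) * \<beta>) / ((\<rho> - real n\<^sub>1) * \<sigma>)"
    using \<rho> by (simp add: mult_ac)
  also have "\<dots> = 1" using balance[symmetric] gap \<sigma> by simp
  finally show ?thesis
    using sums_summable[OF tail] sums_unique[OF tail, symmetric] by simp
qed

end
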